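(* Let $$a(\lambda)=a_0(\lambda-\alpha_1)^{m_1}\cdots(\lambda-\alpha_s)^{m_s},\qquad b(\lambda)=b_0(\lambda-\beta_1)^{n_1}\cdots(\lambda-\beta_t)^{n_t}$$ be complex polynomials of degrees $m=m_1+\dots+m_s\ge 1$ and $n=n_1+\dots+n_t\ge 1$, with $a_0b_0\ne0$, all $m_k>0$ and $n_\ell>0$, $\alpha_1,\dots,\alpha_s$ pairwise different, and $\beta_1,\dots,\beta_t$ pairwise different. Let $u_{k,i}(\lambda)$ ($k=1,\dots,s$, $i=0,\dots,m_k-1$) be the $m$ fundamental polynomials corresponding to $a$, let $v_{\ell,j}(\lambda)$ ($\ell=1,\dots,t$, $j=0,\dots,n_\ell-1$) be the $n$ fundamental polynomials corresponding to $b$, and let $S=S(a,b)$ be the $(m+n)\times(m+n)$ Sylvester matrix of $a$ and $b$. Suppose $\det S\ne 0$. I. There exist $m$ polynomials $U_{k,i}(\lambda)$, $k=1,\dots,s$, $i=0,\dots,m_k-1$, of degree no larger than $m-1$, and $n$ polynomials $V_{\ell,j}(\lambda)$, $\ell=1,\dots,t$, $j=0,\dots,n_\ell-1$, of degree no larger than $n-1$, such that $$S(a,b)^{-1}=\sum_{k=1}^s\sum_{i=0}^{m_k-1}\Lambda^{[i]}(\alpha_k)\,\big[\underbrace{0,\dots,0}_{n},\ \mathrm{row}_m(U_{k,i}(\lambda))\big]+\sum_{\ell=1}^t\sum_{j=0}^{n_\ell-1}\Lambda^{[j]}(\beta_\ell)\,\big[\mathrm{row}_n(V_{\ell,j}(\lambda)),\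 \underbrace{0,\dots,0}_{m}\big].$$ The polynomials $U_{k,i}$ and $V_{\ell,j}$ satisfying this identity and these restrictions on their degrees are unique. II. For each fixed $k=1,\dots,s$ the $m_k$ polynomials $U_{k,i}$, $i=0,1,\dots,m_k-1$, can be found successively, beginning with $i=m_k-1$, by the recurrence $$U_{k,i}(\lambda)=\frac{1}{b(\alpha_k)}\Big[u_{k,i}(\lambda)-\sum_{i_1=i+1}^{m_k-1}\binom{i_1}{i}\,b^{[i_1-i]}(\alpha_k)\,U_{k,i_1}(\lambda)\Big],\qquad i=m_k-1,m_k-2,\dots,1,0.$$ For each fixed $\ell=1,\dots,t$ the $n_\ell$ polynomials $V_{\ell,j}$, $j=0,1,\dots,n_\ell-1$, can be found successively, beginning with $j=n_\ell-1$, by the recurrence $$V_{\ell,j}(\lambda)=\frac{1}{a(\beta_\ell)}\Big[v_{\ell,j}(\lambda)-\sum_{j_1=j+1}^{n_\ell-1}\binom{j_1}{j}\,a^{[j_1-j]}(\beta_\ell)\,V_{\ell,j_1}(\lambda)\Big],\qquad j=n_\ell-1,n_\ell-2,\dots,1,0.$$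
   Context: A superscript $[r]$ denotes the $r$-th derivative with respect to $\lambda$ ($[0]$ meaning no differentiation). Empty sums are $0$; $\binom{p}{q}=\frac{p!}{q!(p-q)!}$. Sylvester matrix: writing $a(\lambda)=a_0\lambda^m+a_1\lambda^{m-1}+\dots+a_m$ and $b(\lambda)=b_0\lambda^n+b_1\lambda^{n-1}+\dots+b_n$, $S(a,b)$ is the $(m+n)\times(m+n)$ matrix whose first $n$ rows are the successive right shifts of $[a_0,a_1,\dots,a_m,0,\dots,0]$ (row $p$, $1\le p\le n$, has $p-1$ zeros, then $a_0,\dots,a_m$, then $n-p$ zeros), and whose last $m$ rows are the successive right shifts of $[b_0,b_1,\dots,b_n,0,\dots,0]$ (row $n+p$, $1\le p\le m$, has $p-1$ zeros, then $b_0,\dots,b_n$, then $m-p$ zeros). $\Lambda(\lambda)$ denotes the column of height $m+n$ with entries $\lambda^{m+n-1},\lambda^{m+n-2},\dots,\lambda,1$ from top to bottom, and $\Lambda^{[r]}(\lambda)$ its entrywise $r$-th derivative. For a polynomial $p(\lambda)=p_0\lambda^{k-1}+p_1\lambda^{k-2}+\dots+p_{k-1}$ of degree at most $k-1$, $\mathrm{row}_k(p(\lambda))$ denotes the row $[p_0,p_1,\dots,p_{k-1}]$. Fundamental polynomials: the fundamental polynomials $u_{k,i}$ corresponding to $a$ are the unique polynomials of degree no larger than $m-1$ such that, for every function $f$ having derivatives up to order $m_k-1$ at $\alpha_k$ for each $k$, the polynomial $p(\lambda)=\sum_{k=1}^s\sum_{i=0}^{m_k-1}f^{[i]}(\alpha_k)u_{k,i}(\lambda)$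 satisfies $p^{[i]}(\alpha_k)=f^{[i]}(\alpha_k)$ for all $k=1,\dots,s$, $i=0,\dots,m_k-1$ (general Hermite interpolation). Equivalently, $u_{k,i}^{[i']}(\alpha_{k'})$ equals $1$ if $(k',i')=(k,i)$ and $0$ otherwise, for $1\le k'\le s$, $0\le i'\le m_{k'}-1$. The fundamental polynomials $v_{\ell,j}$ corresponding to $b$ (of degree no larger than $n-1$) are defined in the same way from the zeros $\beta_\ell$ with multiplicities $n_\ell$. *)

theory Defs
  imports "HOL-Analysis.Analysis" "HOL-Computational_Algebra.Field_as_Ring"
    "Subresultants.Resultant_Prelim"
begin

section \<open>Hermite interpolation and fundamental polynomials\<close>

text \<open>A derivative of order \<open>i + 1 \<le> r\<close> at \<open>x\<close> is the derivative at \<open>x\<close> of the derivative of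
  order \<open>i\<close>; for \<open>i + 1 < r\<close> it has to exist in a whole neighbourhood of \<open>x\<close>, so that it can be
  differentiated again.\<close>

definition has_derivs_upto :: "(complex \<Rightarrow> complex) \<Rightarrow> complex \<Rightarrow> nat \<Rightarrow> bool" where
  "has_derivs_upto f x r \<longleftrightarrow>
     (\<forall>i<r. (deriv ^^ i) f field_differentiable at x) \<and>
     (\<forall>i. i + 1 < r \<longrightarrow> (\<forall>\<^sub>F z in nhds x. (deriv ^^ i) f field_differentiable at z))"

definition hermite_interpolates ::
  "nat \<Rightarrow> (nat \<Rightarrow> complex) \<Rightarrow> (nat \<Rightarrow> nat) \<Rightarrow> (complex \<Rightarrow> complex) \<Rightarrow> complex poly \<Rightarrow> bool" where
  "hermite_interpolates s \<alpha> \<mu> f p \<longleftrightarrow>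
     (\<forall>k\<in>{1..s}. \<forall>i<\<mu> k. poly ((pderiv ^^ i) p) (\<alpha> k) = (deriv ^^ i) f (\<alpha> k))"

text \<open>The zeros are \<open>\<alpha> 1, \<dots>, \<alpha> s\<close> with multiplicities \<open>\<mu> 1, \<dots>, \<mu> s\<close>; values of \<open>u k i\<close> outside the
  range \<open>1 \<le> k \<le> s\<close>, \<open>i < \<mu> k\<close> are irrelevant.  Existence and uniqueness are
  \<open>fundamental_polys_exist\<close> and \<open>fundamental_polys_unique\<close> below.\<close>

definition fundamental_polys ::
  "nat \<Rightarrow> (nat \<Rightarrow> complex) \<Rightarrow> (nat \<Rightarrow> nat) \<Rightarrow> (nat \<Rightarrow> nat \<Rightarrow> complex poly) \<Rightarrow> bool" where
  "fundamental_polys s \<alpha> \<mu> u \<longleftrightarrow>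
     (\<forall>k\<in>{1..s}. \<forall>i<\<mu> k. degree (u k i) \<le> (\<Sum>k=1..s. \<mu> k) - 1) \<and>
     (\<forall>f. (\<forall>k\<in>{1..s}. has_derivs_upto f (\<alpha> k) (\<mu> k - 1)) \<longrightarrow>
        hermite_interpolates s \<alpha> \<mu> f
          (\<Sum>k=1..s. \<Sum>i<\<mu> k. Polynomial.smult ((deriv ^^ i) f (\<alpha> k)) (u k i)))"

lemma deriv_poly: "deriv (poly p) = poly (pderiv (p :: complex poly))"
  by (rule ext, rule DERIV_imp_deriv) simp

lemma higher_deriv_poly: "(deriv ^^ i) (poly p) = poly ((pderiv ^^ i) (p :: complex poly))"
  by (induction i) (simp_all add: deriv_poly)

lemma has_derivs_upto_poly: "has_derivs_upto (poly p) x r"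
proof -
  have "poly q field_differentiable at z" for q :: "complex poly" and z
    by (meson field_differentiable_def poly_DERIV)
  then show ?thesis
    unfolding has_derivs_upto_def higher_deriv_poly by simp
qed

lemma higher_pderiv_diff:
  fixes p q :: "'a :: field_char_0 poly"
  shows "(pderiv ^^ i) (p - q) = (pderiv ^^ i) p - (pderiv ^^ i) q"
  by (induction i) (simp_all add: pderiv_diff)

lemma higher_pderiv_linear_power_zero:
  fixes p :: "'a :: field_char_0 poly"
  assumes "[:-x, 1:] ^ n dvd p" "i < n"
  shows "poly ((pderiv ^^ i) p) x = 0"
  using assms
proof (induction i arbitrary: n p)
  case 0
  then have "[:-x, 1:] dvd p"
    by (metis dvd_power dvd_trans)
  then show ?case by (simp add: poly_eq_0_iff_dvd)
next
  case (Suc i)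
  then obtain n' where n: "n = Suc n'" "i < n'" by (cases n) auto
  from Suc.prems obtain r where p: "p = [:-x, 1:] ^ Suc n' * r" using n by auto
  have "[:-x, 1:] ^ n' dvd pderiv p"
    unfolding p pderiv_mult pderiv_power_Suc
    by (intro dvd_add dvd_mult dvd_mult2 dvd_smult dvd_refl le_imp_power_dvd) simp_all
  from Suc.IH[OF this n(2)] show ?case by (simp add: funpow_swap1)
qed

lemma higher_pderiv_linear_power:
  fixes r :: "'a :: field_char_0 poly"
  shows "poly ((pderiv ^^ n) ([:-x, 1:] ^ n * r)) x = fact n * poly r x"
proof (induction n arbitrary: r)
  case (Suc n)
  have "pderiv ([:-x, 1:] ^ Suc n * r) =
      [:-x, 1:] ^ n * ([:-x, 1:] * pderiv r + Polynomial.smult (of_nat (Suc n)) r)"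
    unfolding pderiv_mult pderiv_power_Suc
    by (simp add: pderiv_pCons algebra_simps)
  then have "(pderiv ^^ Suc n) ([:-x, 1:] ^ Suc n * r) = (pderiv ^^ n)
      ([:-x, 1:] ^ n * ([:-x, 1:] * pderiv r + Polynomial.smult (of_nat (Suc n)) r))"
    by (simp add: funpow_swap1 del: power_Suc of_nat_Suc)
  then show ?case
    unfolding Suc.IH by (simp only: Suc.IH) (simp add: algebra_simps)
qed simp

lemma linear_power_dvd_iff:
  fixes p :: "'a :: field_char_0 poly"
  shows "[:-x, 1:] ^ n dvd p \<longleftrightarrow> (\<forall>i<n. poly ((pderiv ^^ i) p) x = 0)"
proof
  show "[:-x, 1:] ^ n dvd p" if "\<forall>i<n. poly ((pderiv ^^ i) p) x = 0"
    using that
  proof (induction n)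
    case (Suc n)
    then obtain r where p: "p = [:-x, 1:] ^ n * r" by auto
    have "fact n * poly r x = 0"
      using Suc.prems higher_pderiv_linear_power[of n x r] p by auto
    then have "[:-x, 1:] dvd r" by (simp add: poly_eq_0_iff_dvd)
    then show ?case unfolding p by (metis mult_dvd_mono dvd_refl power_Suc2)
  qed simp
qed (use higher_pderiv_linear_power_zero in blast)

lemma hermite_exists:
  fixes \<alpha> :: "'i \<Rightarrow> 'a :: field_char_0"
  assumes "finite K" "inj_on \<alpha> K"
  shows "\<exists>p. \<forall>k\<in>K. \<forall>i<\<mu> k. poly ((pderiv ^^ i) p) (\<alpha> k) = c k i"
  using assms
proof (induction K)
  case (insert k K)
  then obtain p where p: "\<And>j i. j \<in> K \<Longrightarrow> i < \<mu> j \<Longrightarrow> poly ((pderiv ^^ i) p) (\<alpha> j) = c j i"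
    by (auto simp: inj_on_def)
  define w where "w = (\<Prod>j\<in>K. [:-\<alpha> j, 1:] ^ \<mu> j)"
  have w: "poly w (\<alpha> k) \<noteq> 0"
    unfolding w_def poly_prod using insert.prems insert.hyps by (auto simp: inj_on_def)
  have dvd: "[:-\<alpha> j, 1:] ^ \<mu> j dvd w" if "j \<in> K" for j
    unfolding w_def using that insert.hyps by (intro dvd_prodI)
  have "\<exists>r. \<forall>i<n. poly ((pderiv ^^ i) (p + w * r)) (\<alpha> k) = c k i" for n
  proof (induction n)
    case (Suc n)
    then obtain r where r: "\<And>i. i < n \<Longrightarrow> poly ((pderiv ^^ i) (p + w * r)) (\<alpha> k) = c k i"
      by auto
    define d where "d = (c k n - poly ((pderiv ^^ n) (p + w * r)) (\<alpha> k)) / (fact n * poly w (\<alpha> k))"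
    define q where "q = [:-\<alpha> k, 1:] ^ n * Polynomial.smult d w"
    have eq: "p + w * (r + Polynomial.smult d ([:-\<alpha> k, 1:] ^ n)) = (p + w * r) + q"
      by (simp add: q_def algebra_simps)
    have "poly ((pderiv ^^ i) (p + w * (r + Polynomial.smult d ([:-\<alpha> k, 1:] ^ n)))) (\<alpha> k) = c k i"
      if "i < Suc n" for i
    proof (cases "i = n")
      case True
      have "poly ((pderiv ^^ n) q) (\<alpha> k) = fact n * (d * poly w (\<alpha> k))"
        unfolding q_def higher_pderiv_linear_power by simp
      then show ?thesis
        unfolding eq higher_pderiv_add[of _ "p + w * r"] poly_add True using w by (simp add: d_def)
    next
      case False
      then have "poly ((pderiv ^^ i) q) (\<alpha> k) = 0"
        using that unfolding q_def
        by (intro higher_pderiv_linear_power_zero[of _ n] dvd_triv_left) auto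
      then show ?thesis
        unfolding eq higher_pderiv_add[of _ "p + w * r"] poly_add using r[of i] that False by simp
    qed
    then show ?case by blast
  qed simp
  then obtain r where r: "\<And>i. i < \<mu> k \<Longrightarrow> poly ((pderiv ^^ i) (p + w * r)) (\<alpha> k) = c k i"
    by blast
  have "poly ((pderiv ^^ i) (p + w * r)) (\<alpha> j) = c j i" if "j \<in> K" "i < \<mu> j" for i j
    using p[OF that] higher_pderiv_linear_power_zero[OF dvd_mult2[OF dvd[OF that(1)]] that(2)]
    by (simp add: higher_pderiv_add)
  with r show ?case by blast
qed simp

lemma degree_prod_linear_power:
  fixes \<alpha> :: "'i \<Rightarrow> 'a :: field_char_0"
  assumes "finite K"
  shows "degree (\<Prod>k\<in>K. [:-\<alpha> k, 1:] ^ \<mu> k) = (\<Sum>k\<in>K. \<mu> k)"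
  using assms by (subst degree_prod_eq_sum_degree) (auto simp: degree_power_eq)

lemma hermite_exists_degree:
  fixes \<alpha> :: "'i \<Rightarrow> 'a :: field_char_0"
  assumes K: "finite K" "inj_on \<alpha> K"
  shows "\<exists>p. degree p \<le> (\<Sum>k\<in>K. \<mu> k) - 1 \<and>
    (\<forall>k\<in>K. \<forall>i<\<mu> k. poly ((pderiv ^^ i) p) (\<alpha> k) = c k i)"
proof -
  obtain p where p: "\<forall>k\<in>K. \<forall>i<\<mu> k. poly ((pderiv ^^ i) p) (\<alpha> k) = c k i"
    using hermite_exists[OF K] by blast
  define w where "w = (\<Prod>j\<in>K. [:-\<alpha> j, 1:] ^ \<mu> j)"
  have w0: "w \<noteq> 0" unfolding w_def using K by auto
  have dw: "degree w = (\<Sum>k\<in>K. \<mu> k)" unfolding w_def using K by (rule_tac degree_prod_linear_power)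
  have "degree (p mod w) \<le> (\<Sum>k\<in>K. \<mu> k) - 1"
    using degree_mod_less[OF w0, of p] dw by auto
  moreover have "poly ((pderiv ^^ i) (p mod w)) (\<alpha> k) = c k i" if "k \<in> K" "i < \<mu> k" for k i
  proof -
    have "[:-\<alpha> k, 1:] ^ \<mu> k dvd w" unfolding w_def using that K by (intro dvd_prodI)
    then have "[:-\<alpha> k, 1:] ^ \<mu> k dvd p - p mod w"
      by (metis dvd_trans minus_mod_eq_mult_div dvd_triv_left)
    from higher_pderiv_linear_power_zero[OF this that(2)] show ?thesis
      using p that by (simp add: higher_pderiv_diff)
  qed
  ultimately show ?thesis by blast
qed

lemma coprime_linear_polys:
  fixes x y :: "'a :: field_gcd"
  assumes "x \<noteq> y"
  shows "coprime [:-x, 1:] [:-y, 1:]"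
proof (rule coprimeI)
  fix c assume "c dvd [:-x, 1:]" "c dvd [:-y, 1:]"
  then have "c dvd [:-x, 1:] - [:-y, 1:]" by (rule dvd_diff)
  also have "[:-x, 1:] - [:-y, 1:] = [:y - x:]" by simp
  also have "\<dots> dvd 1" using assms by (simp add: is_unit_const_poly_iff)
  finally show "is_unit c" .
qed

lemma prod_dvd_of_coprime:
  fixes f :: "'i \<Rightarrow> 'a :: semiring_gcd"
  assumes "finite K" "\<And>k. k \<in> K \<Longrightarrow> f k dvd p"
    and "\<And>k j. k \<in> K \<Longrightarrow> j \<in> K \<Longrightarrow> k \<noteq> j \<Longrightarrow> coprime (f k) (f j)"
  shows "prod f K dvd p"
  using assms
proof (induction K)
  case (insert k K)
  have "coprime (f k) (prod f K)"
    using insert.prems(2) insert.hyps by (intro prod_coprime_right) auto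
  then show ?case using insert by (auto intro!: divides_mult)
qed simp

lemma hermite_unique:
  fixes \<alpha> :: "'i \<Rightarrow> complex"
  assumes K: "finite K" "inj_on \<alpha> K" and m: "(\<Sum>k\<in>K. \<mu> k) \<ge> 1"
    and p: "degree p \<le> (\<Sum>k\<in>K. \<mu> k) - 1" and q: "degree q \<le> (\<Sum>k\<in>K. \<mu> k) - 1"
    and eq: "\<And>k i. k \<in> K \<Longrightarrow> i < \<mu> k \<Longrightarrow>
      poly ((pderiv ^^ i) p) (\<alpha> k) = poly ((pderiv ^^ i) q) (\<alpha> k)"
  shows "p = q"
proof (rule ccontr)
  assume "p \<noteq> q"
  then have ne: "p - q \<noteq> 0" by simp
  have "[:-\<alpha> k, 1:] ^ \<mu> k dvd p - q" if "k \<in> K" for k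
    unfolding linear_power_dvd_iff using eq that by (simp add: higher_pderiv_diff)
  moreover have "coprime ([:-\<alpha> k, 1:] ^ \<mu> k) ([:-\<alpha> j, 1:] ^ \<mu> j)"
    if "k \<in> K" "j \<in> K" "k \<noteq> j" for k j
  proof -
    have "\<alpha> k \<noteq> \<alpha> j" using K that by (auto simp: inj_on_def)
    then have "coprime [:-\<alpha> k, 1:] [:-\<alpha> j, 1:]"
      by (rule coprime_linear_polys)
    then show ?thesis by simp
  qed
  ultimately have "(\<Prod>k\<in>K. [:-\<alpha> k, 1:] ^ \<mu> k) dvd p - q"
    using K(1) by (intro prod_dvd_of_coprime)
  then have "(\<Sum>k\<in>K. \<mu> k) \<le> degree (p - q)"
    using dvd_imp_degree_le[OF _ ne] degree_prod_linear_power[OF K(1), of \<alpha> \<mu>] by metis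
  moreover have "degree (p - q) \<le> (\<Sum>k\<in>K. \<mu> k) - 1" using p q by (rule degree_diff_le)
  ultimately show False using m by simp
qed

lemma fundamental_polys_iff:
  assumes inj: "inj_on \<alpha> {1..s}"
  shows "fundamental_polys s \<alpha> \<mu> u \<longleftrightarrow>
     (\<forall>k\<in>{1..s}. \<forall>i<\<mu> k. degree (u k i) \<le> (\<Sum>k=1..s. \<mu> k) - 1) \<and>
     (\<forall>k\<in>{1..s}. \<forall>i<\<mu> k. \<forall>k'\<in>{1..s}. \<forall>i'<\<mu> k'.
        poly ((pderiv ^^ i') (u k i)) (\<alpha> k') = (if k' = k \<and> i' = i then 1 else 0))"
    (is "?F \<longleftrightarrow> ?D \<and> ?B")
proof
  assume F: ?F
  have ?B
  proof (intro ballI allI impI)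
    fix k i k' i' assume k: "k \<in> {1..s}" "i < \<mu> k" and k': "k' \<in> {1..s}" "i' < \<mu> k'"
    obtain h where h: "\<forall>j\<in>{1..s}. \<forall>l<\<mu> j. poly ((pderiv ^^ l) h) (\<alpha> j) =
        (if j = k \<and> l = i then 1 else 0)"
      using hermite_exists[OF _ inj, of \<mu> "\<lambda>j l. if j = k \<and> l = i then 1 else 0"] by auto
    have "hermite_interpolates s \<alpha> \<mu> (poly h)
        (\<Sum>k=1..s. \<Sum>i<\<mu> k. Polynomial.smult ((deriv ^^ i) (poly h) (\<alpha> k)) (u k i))"
      using F has_derivs_upto_poly unfolding fundamental_polys_def by blast
    also have "(\<Sum>k=1..s. \<Sum>i<\<mu> k. Polynomial.smult ((deriv ^^ i) (poly h) (\<alpha> k)) (u k i)) =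
        (\<Sum>j=1..s. \<Sum>l<\<mu> j. if j = k then if l = i then u j l else 0 else 0)"
      using h by (intro sum.cong) (auto simp: higher_deriv_poly)
    also have "\<dots> = (\<Sum>j=1..s. if j = k then \<Sum>l<\<mu> j. if l = i then u j l else 0 else 0)"
      by (intro sum.cong) auto
    also have "\<dots> = u k i"
      using k by simp
    finally show "poly ((pderiv ^^ i') (u k i)) (\<alpha> k') = (if k' = k \<and> i' = i then 1 else 0)"
      using k' h unfolding hermite_interpolates_def by (auto simp: higher_deriv_poly)
  qed
  with F show "?D \<and> ?B" unfolding fundamental_polys_def by blast
next
  assume DB: "?D \<and> ?B"
  have "poly ((pderiv ^^ i) (\<Sum>k=1..s. \<Sum>i<\<mu> k. Polynomial.smult ((deriv ^^ i) f (\<alpha> k)) (u k i))) (\<alpha> k)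
      = (deriv ^^ i) f (\<alpha> k)" if k: "k \<in> {1..s}" "i < \<mu> k" for k i f
  proof -
    have "poly ((pderiv ^^ i) (\<Sum>k=1..s. \<Sum>i<\<mu> k. Polynomial.smult ((deriv ^^ i) f (\<alpha> k)) (u k i))) (\<alpha> k)
      = (\<Sum>j=1..s. \<Sum>l<\<mu> j. (deriv ^^ l) f (\<alpha> j) * poly ((pderiv ^^ i) (u j l)) (\<alpha> k))"
      by (simp add: higher_pderiv_sum higher_pderiv_smult poly_sum)
    also have "\<dots> = (\<Sum>j=1..s. \<Sum>l<\<mu> j. if j = k then if l = i then (deriv ^^ l) f (\<alpha> j) else 0 else 0)"
      using DB k by (intro sum.cong) auto
    also have "\<dots> = (\<Sum>j=1..s. if j = k then \<Sum>l<\<mu> j. if l = i then (deriv ^^ l) f (\<alpha> j) else 0 else 0)"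
      by (intro sum.cong) auto
    also have "\<dots> = (deriv ^^ i) f (\<alpha> k)"
      using k by simp
    finally show ?thesis .
  qed
  with DB show ?F unfolding fundamental_polys_def hermite_interpolates_def by blast
qed

lemma fundamental_polys_exist:
  assumes "inj_on \<alpha> {1..s}"
  shows "\<exists>u. fundamental_polys s \<alpha> \<mu> u"
proof -
  have "\<exists>p. degree p \<le> (\<Sum>k=1..s. \<mu> k) - 1 \<and> (\<forall>k'\<in>{1..s}. \<forall>i'<\<mu> k'.
      poly ((pderiv ^^ i') p) (\<alpha> k') = (if k' = k \<and> i' = i then 1 else 0))" for k i
    using hermite_exists_degree[OF _ assms, of \<mu> "\<lambda>k' i'. if k' = k \<and> i' = i then 1 else 0"] by auto
  then show ?thesis
    unfolding fundamental_polys_iff[OF assms] by metis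
qed

lemma fundamental_polys_unique:
  assumes "inj_on \<alpha> {1..s}" "(\<Sum>k=1..s. \<mu> k) \<ge> 1"
    and "fundamental_polys s \<alpha> \<mu> u" "fundamental_polys s \<alpha> \<mu> u'"
    and k: "k \<in> {1..s}" "i < \<mu> k"
  shows "u k i = u' k i"
  using assms unfolding fundamental_polys_iff[OF assms(1)]
  by (intro hermite_unique[of "{1..s}" \<alpha> \<mu>]) auto


section \<open>The blocks of the inverse Sylvester matrix\<close>

definition mat_sum :: "nat \<Rightarrow> ('i \<Rightarrow> complex mat) \<Rightarrow> 'i set \<Rightarrow> complex mat" where
  "mat_sum N F A = finsum (module_mat TYPE(complex) N N) F A"

lemma mat_sum_carrier:
  assumes "\<And>x. x \<in> A \<Longrightarrow> F x \<in> carrier_mat N N"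
  shows "mat_sum N F A \<in> carrier_mat N N"
proof -
  interpret abelian_group "module_mat TYPE(complex) N N" by (rule abelian_group_mat)
  show ?thesis unfolding mat_sum_def
    using finsum_closed[of F A] assms by (auto simp: module_mat_simps)
qed

lemma index_mat_sum:
  assumes "finite A" "\<And>x. x \<in> A \<Longrightarrow> F x \<in> carrier_mat N N" "r < N" "c < N"
  shows "mat_sum N F A $$ (r, c) = (\<Sum>x\<in>A. F x $$ (r, c))"
proof -
  interpret abelian_group "module_mat TYPE(complex) N N" by (rule abelian_group_mat)
  show ?thesis using assms
  proof (induction A)
    case empty
    then show ?case by (simp add: mat_sum_def module_mat_simps)
  next
    case (insert x A)
    have "mat_sum N F (insert x A) = F x + mat_sum N F A"
      unfolding mat_sum_def using insert by (subst finsum_insert) (auto simp: module_mat_simps)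
    then show ?case using insert mat_sum_carrier[of A F N] by auto
  qed
qed

text \<open>\<open>Lambda_deriv N r x\<close> is the entrywise \<open>r\<close>-th derivative at \<open>x\<close> of the column of height \<open>N\<close>
  with entries \<open>x^(N - 1), \<dots>, x, 1\<close>.\<close>

definition Lambda_deriv :: "nat \<Rightarrow> nat \<Rightarrow> complex \<Rightarrow> complex mat" where
  "Lambda_deriv N r x =
     mat_of_cols N [Matrix.vec N (\<lambda>j. poly ((pderiv ^^ r) (monom 1 (N - 1 - j))) x)]"

definition row_poly :: "nat \<Rightarrow> complex poly \<Rightarrow> complex Matrix.vec" where
  "row_poly k p = Matrix.vec k (\<lambda>j. coeff p (k - 1 - j))"

text \<open>In the following, \<open>m\<close> and \<open>n\<close> are meant to be the degrees of \<open>a\<close> and \<open>b\<close>.  A term of the sums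
  is a product of a column with a row, each given as a matrix.\<close>

definition sylvester_inv_expr ::
  "nat \<Rightarrow> nat \<Rightarrow> nat \<Rightarrow> (nat \<Rightarrow> complex) \<Rightarrow> (nat \<Rightarrow> nat) \<Rightarrow> nat \<Rightarrow> (nat \<Rightarrow> complex) \<Rightarrow> (nat \<Rightarrow> nat) \<Rightarrow>
   (nat \<Rightarrow> nat \<Rightarrow> complex poly) \<Rightarrow> (nat \<Rightarrow> nat \<Rightarrow> complex poly) \<Rightarrow> complex mat" where
  "sylvester_inv_expr m n s \<alpha> \<mu> t \<beta> \<nu> U V =
     mat_sum (m + n) (\<lambda>k. mat_sum (m + n) (\<lambda>i.
       Lambda_deriv (m + n) i (\<alpha> k) * mat_of_row (0\<^sub>v n @\<^sub>v row_poly m (U k i))) {..<\<mu> k}) {1..s} +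
     mat_sum (m + n) (\<lambda>l. mat_sum (m + n) (\<lambda>j.
       Lambda_deriv (m + n) j (\<beta> l) * mat_of_row (row_poly n (V l j) @\<^sub>v 0\<^sub>v m)) {..<\<nu> l}) {1..t}"

definition sylvester_inv_rep ::
  "complex poly \<Rightarrow> complex poly \<Rightarrow> nat \<Rightarrow> nat \<Rightarrow>
   nat \<Rightarrow> (nat \<Rightarrow> complex) \<Rightarrow> (nat \<Rightarrow> nat) \<Rightarrow> nat \<Rightarrow> (nat \<Rightarrow> complex) \<Rightarrow> (nat \<Rightarrow> nat) \<Rightarrow>
   (nat \<Rightarrow> nat \<Rightarrow> complex poly) \<Rightarrow> (nat \<Rightarrow> nat \<Rightarrow> complex poly) \<Rightarrow> bool" where
  "sylvester_inv_rep a b m n s \<alpha> \<mu> t \<beta> \<nu> U V \<longleftrightarrow>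
     (\<forall>k\<in>{1..s}. \<forall>i<\<mu> k. degree (U k i) \<le> m - 1) \<and>
     (\<forall>l\<in>{1..t}. \<forall>j<\<nu> l. degree (V l j) \<le> n - 1) \<and>
     inverts_mat (sylvester_mat a b) (sylvester_inv_expr m n s \<alpha> \<mu> t \<beta> \<nu> U V) \<and>
     inverts_mat (sylvester_inv_expr m n s \<alpha> \<mu> t \<beta> \<nu> U V) (sylvester_mat a b)"

end

theory Submission
  imports Defs
begin

text \<open>The row of \<open>f\<close> (degree below \<open>m + n\<close>) times \<open>\<Lambda>^[i](x)\<close> is the derivative \<open>f^[i](x)\<close>, and the rows
  of the Sylvester matrix are those of \<open>\<lambda>^p a\<close> and \<open>\<lambda>^q b\<close>.  Since \<open>a\<close> vanishes to order \<open>\<mu> k\<close> at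
  \<open>\<alpha> k\<close>, and \<open>b\<close> to order \<open>\<nu> l\<close> at \<open>\<beta> l\<close>, the off-diagonal blocks of \<open>S X = 1\<close> hold automatically, and
  the diagonal ones say that \<open>g = \<Sum> (g b)^[i](\<alpha> k) U k i\<close> for all \<open>g\<close> of degree below \<open>m\<close>, and
  likewise for \<open>V\<close>.  Expanding \<open>(g b)^[i]\<close> by Leibniz turns this into Hermite interpolation of \<open>g\<close>
  by the polynomials \<open>\<Sum>j\<ge>i. (j choose i) b^[j-i](\<alpha> k) U k j\<close>, which therefore must be the fundamental
  ones; this triangular system is the recurrence.\<close>

section \<open>Leibniz's rule for iterated derivatives of polynomials\<close>

lemma higher_pderiv_mult:
  fixes p q :: "'a :: field_char_0 poly"
  shows "(pderiv ^^ n) (p * q) =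
    (\<Sum>i\<le>n. of_nat (n choose i) * ((pderiv ^^ i) p * (pderiv ^^ (n - i)) q))"
proof (induction n)
  case (Suc n)
  let ?T = "\<lambda>c i j. of_nat c * ((pderiv ^^ i) p * (pderiv ^^ j) q)"
  have "(pderiv ^^ Suc n) (p * q) =
      (\<Sum>i\<le>n. ?T (n choose i) (Suc i) (n - i)) + (\<Sum>i\<le>n. ?T (n choose i) i (Suc n - i))"
    by (simp add: Suc.IH pderiv_sum pderiv_mult sum.distrib[symmetric] Suc_diff_le algebra_simps)
  \<comment> \<open>The term added at \<open>i = Suc n\<close> vanishes because
    \<open>n choose Suc n = 0\<close>. Splitting off \<open>i = 0\<close> then lets both sums run
    over the same products, and Pascal's rule adds them.\<close>
  also have "(\<Sum>i\<le>n. ?T (n choose i) i (Suc n - i)) = (\<Sum>i\<le>Suc n. ?T (n choose i) i (Suc n - i))"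
    by simp
  also have "\<dots> = ?T 1 0 (Suc n) + (\<Sum>i\<le>n. ?T (n choose Suc i) (Suc i) (n - i))"
    by (subst sum.atMost_Suc_shift) simp
  also have "(\<Sum>i\<le>n. ?T (n choose i) (Suc i) (n - i)) + \<dots> =
      ?T 1 0 (Suc n) + (\<Sum>i\<le>n. ?T (Suc n choose Suc i) (Suc i) (n - i))"
    by (simp add: sum.distrib[symmetric] algebra_simps)
  also have "\<dots> = (\<Sum>i\<le>Suc n. ?T (Suc n choose i) i (Suc n - i))"
    by (subst sum.atMost_Suc_shift) simp
  finally show ?case .
qed simp

section \<open>Hermite sums\<close>

text \<open>The family \<open>U\<close> is arbitrary. For fundamental polynomials this is the
  Hermite interpolant of \<open>f\<close>; in general it is an operator linear in \<open>f\<close>,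
  and linearity is what most arguments use.\<close>

definition hermite_sum ::
  "nat \<Rightarrow> (nat \<Rightarrow> complex) \<Rightarrow> (nat \<Rightarrow> nat) \<Rightarrow> (nat \<Rightarrow> nat \<Rightarrow> complex poly) \<Rightarrow> complex poly \<Rightarrow> complex poly"
  where "hermite_sum s \<alpha> \<mu> U f =
    (\<Sum>k=1..s. \<Sum>i<\<mu> k. Polynomial.smult (poly ((pderiv ^^ i) f) (\<alpha> k)) (U k i))"

text \<open>For fixed \<open>k\<close> an upper triangular matrix acts on the list
  \<open>U k\<close>; all its diagonal entries are \<open>b(\<alpha> k)\<close>.\<close>

definition leibniz_transform ::
  "(nat \<Rightarrow> complex) \<Rightarrow> (nat \<Rightarrow> nat) \<Rightarrow> complex poly \<Rightarrow> (nat \<Rightarrow> nat \<Rightarrow> complex poly) \<Rightarrow> nat \<Rightarrow> nat \<Rightarrow> complex poly"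
  where "leibniz_transform \<alpha> \<mu> b U k i =
    (\<Sum>j=i..<\<mu> k. Polynomial.smult (of_nat (j choose i) * poly ((pderiv ^^ (j - i)) b) (\<alpha> k)) (U k j))"

lemma hermite_sum_cong:
  assumes "\<And>k i. k \<in> {1..s} \<Longrightarrow> i < \<mu> k \<Longrightarrow> U k i = U' k i"
  shows "hermite_sum s \<alpha> \<mu> U f = hermite_sum s \<alpha> \<mu> U' f"
  unfolding hermite_sum_def using assms by (intro sum.cong) auto

lemma hermite_sum_sum: "hermite_sum s \<alpha> \<mu> U (\<Sum>x\<in>A. f x) = (\<Sum>x\<in>A. hermite_sum s \<alpha> \<mu> U (f x))"
proof -
  have "hermite_sum s \<alpha> \<mu> U (\<Sum>x\<in>A. f x) = (\<Sum>k=1..s. \<Sum>i<\<mu> k. \<Sum>x\<in>A.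
      Polynomial.smult (poly ((pderiv ^^ i) (f x)) (\<alpha> k)) (U k i))"
    unfolding hermite_sum_def by (simp add: higher_pderiv_sum poly_sum Polynomial.smult_sum)
  also have "\<dots> = (\<Sum>k=1..s. \<Sum>x\<in>A. \<Sum>i<\<mu> k.
      Polynomial.smult (poly ((pderiv ^^ i) (f x)) (\<alpha> k)) (U k i))"
    by (intro sum.cong refl sum.swap)
  also have "\<dots> = (\<Sum>x\<in>A. hermite_sum s \<alpha> \<mu> U (f x))"
    unfolding hermite_sum_def by (rule sum.swap)
  finally show ?thesis .
qed

lemma hermite_sum_smult:
  "hermite_sum s \<alpha> \<mu> U (Polynomial.smult c f) = Polynomial.smult c (hermite_sum s \<alpha> \<mu> U f)"
  unfolding hermite_sum_def by (simp add: higher_pderiv_smult Missing_Polynomial.smult_sum2)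

text \<open>Only derivatives of order below the multiplicity enter, and they all vanish. This
  accounts for the off-diagonal blocks of \<open>S X\<close>.\<close>

lemma hermite_sum_eq_0:
  assumes "\<And>k. k \<in> {1..s} \<Longrightarrow> [:- \<alpha> k, 1:] ^ \<mu> k dvd f"
  shows "hermite_sum s \<alpha> \<mu> U f = 0"
  unfolding hermite_sum_def using higher_pderiv_linear_power_zero[OF assms]
  by (intro sum.neutral ballI) auto

lemma degree_hermite_sum_le:
  assumes "\<And>k i. k \<in> {1..s} \<Longrightarrow> i < \<mu> k \<Longrightarrow> degree (U k i) \<le> d"
  shows "degree (hermite_sum s \<alpha> \<mu> U f) \<le> d"
  unfolding hermite_sum_def
  using assms by (intro degree_sum_le ballI order_trans[OF degree_smult_le]) auto

lemma coeff_hermite_sum: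
  "coeff (hermite_sum s \<alpha> \<mu> U f) d =
    (\<Sum>k=1..s. \<Sum>i<\<mu> k. poly ((pderiv ^^ i) f) (\<alpha> k) * coeff (U k i) d)"
  unfolding hermite_sum_def by (simp add: coeff_sum)

text \<open>A factor \<open>b\<close> of the argument can be traded for a change of the family,
  because Leibniz's rule involves \<open>g\<close> only through its derivatives at the same
  nodes.\<close>

lemma hermite_sum_mult:
  "hermite_sum s \<alpha> \<mu> U (g * b) = hermite_sum s \<alpha> \<mu> (leibniz_transform \<alpha> \<mu> b U) g"
proof -
  let ?t = "\<lambda>k j i. Polynomial.smult (poly ((pderiv ^^ i) g) (\<alpha> k) *
    (of_nat (j choose i) * poly ((pderiv ^^ (j - i)) b) (\<alpha> k))) (U k j)"
  have "(\<Sum>j<\<mu> k. Polynomial.smult (poly ((pderiv ^^ j) (g * b)) (\<alpha> k)) (U k j)) =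
      (\<Sum>i<\<mu> k. Polynomial.smult (poly ((pderiv ^^ i) g) (\<alpha> k)) (leibniz_transform \<alpha> \<mu> b U k i))" for k
  proof -
    have "(\<Sum>j<\<mu> k. Polynomial.smult (poly ((pderiv ^^ j) (g * b)) (\<alpha> k)) (U k j)) =
        (\<Sum>j<\<mu> k. \<Sum>i\<le>j. ?t k j i)"
      unfolding higher_pderiv_mult by (simp add: poly_sum Polynomial.smult_sum of_nat_poly mult_ac)
    \<comment> \<open>Summing over the triangle \<open>i \<le> j < \<mu> k\<close> in the other
      order collects everything that multiplies \<open>g^[i](\<alpha> k)\<close>.\<close>
    also have "\<dots> = (\<Sum>i<\<mu> k. \<Sum>j=i..<\<mu> k. ?t k j i)"
      unfolding sum.Sigma[OF finite_lessThan ballI[OF finite_atMost]]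
        sum.Sigma[OF finite_lessThan ballI[OF finite_atLeastLessThan]]
      by (rule sum.reindex_bij_witness[where i = "\<lambda>(i, j). (j, i)" and j = "\<lambda>(j, i). (i, j)"]) auto
    finally show ?thesis by (simp add: leibniz_transform_def Missing_Polynomial.smult_sum2)
  qed
  then show ?thesis unfolding hermite_sum_def by simp
qed

text \<open>The interpolant of \<open>g\<close> and \<open>g\<close> itself share their Hermite data
  and the degree bound, so uniqueness of interpolation identifies them.\<close>

lemma hermite_sum_fundamental:
  assumes "inj_on \<alpha> {1..s}" "(\<Sum>k=1..s. \<mu> k) \<ge> 1" "fundamental_polys s \<alpha> \<mu> u"
    and "degree g \<le> (\<Sum>k=1..s. \<mu> k) - 1"
  shows "hermite_sum s \<alpha> \<mu> u g = g"
proof (rule hermite_unique[OF _ assms(1,2) _ assms(4)])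
  show "degree (hermite_sum s \<alpha> \<mu> u g) \<le> (\<Sum>k=1..s. \<mu> k) - 1"
    using assms(3) unfolding fundamental_polys_def by (intro degree_hermite_sum_le) auto
  have "hermite_interpolates s \<alpha> \<mu> (poly g) (hermite_sum s \<alpha> \<mu> u g)"
    using assms(3) has_derivs_upto_poly
    unfolding fundamental_polys_def hermite_sum_def higher_deriv_poly[symmetric] by blast
  then show "poly ((pderiv ^^ i) (hermite_sum s \<alpha> \<mu> u g)) (\<alpha> k) = poly ((pderiv ^^ i) g) (\<alpha> k)"
    if "k \<in> {1..s}" "i < \<mu> k" for k i
    using that unfolding hermite_interpolates_def higher_deriv_poly by blast
qed simp

text \<open>The Hermite data of \<open>u k i\<close> are a Kronecker delta. Hence the operator of
  any family \<open>W\<close> determines \<open>W\<close>, with \<open>u k i\<close> as test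
  argument.\<close>

lemma hermite_sum_fundamental_eval:
  assumes "inj_on \<alpha> {1..s}" "fundamental_polys s \<alpha> \<mu> u" and k: "k \<in> {1..s}" "i < \<mu> k"
  shows "hermite_sum s \<alpha> \<mu> W (u k i) = W k i"
proof -
  have "hermite_sum s \<alpha> \<mu> W (u k i) =
      (\<Sum>j=1..s. \<Sum>l<\<mu> j. if j = k then if l = i then W j l else 0 else 0)"
    unfolding hermite_sum_def using assms(2) k unfolding fundamental_polys_iff[OF assms(1)]
    by (intro sum.cong) auto
  also have "\<dots> = (\<Sum>j=1..s. if j = k then \<Sum>l<\<mu> j. if l = i then W j l else 0 else 0)"
    by (intro sum.cong) auto
  also have "\<dots> = W k i" using k by simp
  finally show ?thesis .
qed

text \<open>By linearity the condition on monomials says that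
  \<open>g \<mapsto> hermite_sum s \<alpha> \<mu> U (g * b)\<close> fixes every \<open>g\<close> of
  small degree. Moving \<open>b\<close> into the family and testing with \<open>g = u k i\<close>
  reads off the transform; the converse is the reproducing property of \<open>u\<close>.\<close>

lemma hermite_sum_mult_eq_iff:
  assumes inj: "inj_on \<alpha> {1..s}" and m: "(\<Sum>k=1..s. \<mu> k) \<ge> 1" and u: "fundamental_polys s \<alpha> \<mu> u"
  shows "(\<forall>q<\<Sum>k=1..s. \<mu> k. hermite_sum s \<alpha> \<mu> U (monom 1 q * b) = monom 1 q) \<longleftrightarrow>
    (\<forall>k\<in>{1..s}. \<forall>i<\<mu> k. leibniz_transform \<alpha> \<mu> b U k i = u k i)" (is "?L \<longleftrightarrow> ?R")
proof
  assume L: ?L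
  have *: "hermite_sum s \<alpha> \<mu> U (g * b) = g" if deg: "degree g \<le> (\<Sum>k=1..s. \<mu> k) - 1" for g
  proof -
    let ?d = "(\<Sum>k=1..s. \<mu> k) - 1"
    have g: "g = (\<Sum>q\<le>?d. Polynomial.smult (coeff g q) (monom 1 q))"
      using poly_as_sum_of_monoms'[OF deg] by (simp add: smult_monom)
    have "hermite_sum s \<alpha> \<mu> U (g * b) =
        (\<Sum>q\<le>?d. Polynomial.smult (coeff g q) (hermite_sum s \<alpha> \<mu> U (monom 1 q * b)))"
      by (subst g) (simp only: sum_distrib_right hermite_sum_sum mult_smult_left hermite_sum_smult)
    also have "\<dots> = (\<Sum>q\<le>?d. Polynomial.smult (coeff g q) (monom 1 q))"
      using L m by (intro sum.cong refl) auto
    also have "\<dots> = g" by (rule g[symmetric])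
    finally show ?thesis .
  qed
  show ?R
  proof (intro ballI allI impI)
    fix k i assume k: "k \<in> {1..s}" "i < \<mu> k"
    then have "degree (u k i) \<le> (\<Sum>k=1..s. \<mu> k) - 1"
      using u unfolding fundamental_polys_def by blast
    from *[OF this] show "leibniz_transform \<alpha> \<mu> b U k i = u k i"
      unfolding hermite_sum_mult hermite_sum_fundamental_eval[OF inj u k] .
  qed
next
  assume R: ?R
  show ?L
  proof (intro allI impI)
    fix q assume q: "q < (\<Sum>k=1..s. \<mu> k)"
    have "hermite_sum s \<alpha> \<mu> U (monom 1 q * b) = hermite_sum s \<alpha> \<mu> u (monom 1 q)"
      unfolding hermite_sum_mult using R by (intro hermite_sum_cong) auto
    also have "\<dots> = monom 1 q"
      using q by (intro hermite_sum_fundamental[OF inj m u]) (auto simp: degree_monom_eq)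
    finally show "hermite_sum s \<alpha> \<mu> U (monom 1 q * b) = monom 1 q" .
  qed
qed

section \<open>The triangular recurrence\<close>

text \<open>The term with \<open>j = i\<close> is \<open>b(\<alpha> k) U k i\<close>. Isolating it
  and dividing by \<open>b(\<alpha> k)\<close> leaves only higher indices on the right, which is the
  recurrence.\<close>

lemma leibniz_transform_eq_iff:
  assumes "poly b (\<alpha> k) \<noteq> 0" "i < \<mu> k"
  shows "leibniz_transform \<alpha> \<mu> b U k i = w \<longleftrightarrow>
    U k i = Polynomial.smult (1 / poly b (\<alpha> k))
      (w - (\<Sum>i1=i+1..<\<mu> k. Polynomial.smult
         (of_nat (i1 choose i) * poly ((pderiv ^^ (i1 - i)) b) (\<alpha> k)) (U k i1)))"
proof -
  let ?r = "\<Sum>i1=i+1..<\<mu> k. Polynomial.smult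
    (of_nat (i1 choose i) * poly ((pderiv ^^ (i1 - i)) b) (\<alpha> k)) (U k i1)"
  let ?c = "poly b (\<alpha> k)"
  have "leibniz_transform \<alpha> \<mu> b U k i = Polynomial.smult ?c (U k i) + ?r"
    unfolding leibniz_transform_def using assms(2) by (subst sum.atLeast_Suc_lessThan) auto
  also have "\<dots> = w \<longleftrightarrow> Polynomial.smult ?c (U k i) = w - ?r"
    by (simp add: algebra_simps)
  also have "\<dots> \<longleftrightarrow> U k i = Polynomial.smult (1 / ?c) (w - ?r)"
  proof
    assume "Polynomial.smult ?c (U k i) = w - ?r"
    then have "Polynomial.smult (1 / ?c) (w - ?r) = Polynomial.smult (1 / ?c) (Polynomial.smult ?c (U k i))"
      by simp
    with assms(1) show "U k i = Polynomial.smult (1 / ?c) (w - ?r)" by simp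
  next
    assume "U k i = Polynomial.smult (1 / ?c) (w - ?r)"
    with assms(1) show "Polynomial.smult ?c (U k i) = w - ?r" by simp
  qed
  finally show ?thesis .
qed

text \<open>Back substitution: induction on \<open>\<mu> k - i\<close> proceeds downwards from the
  last index, where the sum is empty.\<close>

lemma leibniz_transform_inj:
  assumes b: "poly b (\<alpha> k) \<noteq> 0"
    and eq: "\<And>i. i < \<mu> k \<Longrightarrow> leibniz_transform \<alpha> \<mu> b U k i = leibniz_transform \<alpha> \<mu> b U' k i"
    and "i < \<mu> k"
  shows "U k i = U' k i"
  using \<open>i < \<mu> k\<close>
proof (induction "\<mu> k - i" arbitrary: i rule: less_induct)
  case less
  have IH: "U k j = U' k j" if "j \<in> {i + 1..<\<mu> k}" for j
    using that less.prems by (intro less.hyps) auto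
  \<comment> \<open>The recurrence is taken with the transform of \<open>U'\<close> as right-hand
    side; \<open>U\<close> satisfies it by \<open>eq\<close>, and \<open>U'\<close>
    trivially.\<close>
  have "U k i = Polynomial.smult (1 / poly b (\<alpha> k))
      (leibniz_transform \<alpha> \<mu> b U' k i - (\<Sum>i1=i+1..<\<mu> k. Polynomial.smult
         (of_nat (i1 choose i) * poly ((pderiv ^^ (i1 - i)) b) (\<alpha> k)) (U k i1)))"
    using leibniz_transform_eq_iff[where U = U and \<alpha> = \<alpha> and \<mu> = \<mu> and k = k, OF b less.prems] eq[OF less.prems] by blast
  also have "\<dots> = Polynomial.smult (1 / poly b (\<alpha> k))
      (leibniz_transform \<alpha> \<mu> b U' k i - (\<Sum>i1=i+1..<\<mu> k. Polynomial.smult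
         (of_nat (i1 choose i) * poly ((pderiv ^^ (i1 - i)) b) (\<alpha> k)) (U' k i1)))"
    using IH by simp
  also have "\<dots> = U' k i"
    using leibniz_transform_eq_iff[where U = U' and \<alpha> = \<alpha> and \<mu> = \<mu> and k = k, OF b less.prems] by metis
  finally show ?case .
qed

text \<open>Back substitution for an upper triangular system of size \<open>M\<close>:
  \<open>d\<close> is the inverse of the constant diagonal entry, \<open>c\<close> holds the entries
  above it, and \<open>w\<close> is the right-hand side.\<close>

function triangular_solve ::
  "nat \<Rightarrow> complex \<Rightarrow> (nat \<Rightarrow> nat \<Rightarrow> complex) \<Rightarrow> (nat \<Rightarrow> complex poly) \<Rightarrow> nat \<Rightarrow> complex poly" where
  "triangular_solve M d c w i = Polynomial.smult d
     (w i - (\<Sum>j=i+1..<M. Polynomial.smult (c i j) (triangular_solve M d c w j)))"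
  by pat_completeness auto
termination by (relation "Wellfounded.measure (\<lambda>(M, d, c, w, i). M - i)") auto

declare triangular_solve.simps [simp del]

lemma degree_triangular_solve_le:
  assumes "\<And>i. i < M \<Longrightarrow> degree (w i) \<le> D" "i < M"
  shows "degree (triangular_solve M d c w i) \<le> D"
  using assms(2)
proof (induction "M - i" arbitrary: i rule: less_induct)
  case less
  have "degree (triangular_solve M d c w j) \<le> D" if "j \<in> {i+1..<M}" for j
    using that less.prems by (intro less.hyps) auto
  then show ?case
    unfolding triangular_solve.simps[of M d c w i]
    by (intro order_trans[OF degree_smult_le] degree_diff_le degree_sum_le assms(1) less.prems)
      auto
qed

text \<open>With the Leibniz coefficients inserted, the defining equation of
  \<open>triangular_solve\<close> is the rearranged transform equation. Back substitution only forms
  linear combinations, so it keeps the degree bound \<open>D\<close>.\<close>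

lemma leibniz_transform_surj:
  assumes b: "\<And>k. k \<in> K \<Longrightarrow> poly b (\<alpha> k) \<noteq> 0"
    and deg: "\<And>k i. k \<in> K \<Longrightarrow> i < \<mu> k \<Longrightarrow> degree (w k i) \<le> D"
  shows "\<exists>U. \<forall>k\<in>K. \<forall>i<\<mu> k. degree (U k i) \<le> D \<and> leibniz_transform \<alpha> \<mu> b U k i = w k i"
proof -
  define U where "U k = triangular_solve (\<mu> k) (1 / poly b (\<alpha> k))
    (\<lambda>i i1. of_nat (i1 choose i) * poly ((pderiv ^^ (i1 - i)) b) (\<alpha> k)) (w k)" for k
  have "leibniz_transform \<alpha> \<mu> b U k i = w k i" if "k \<in> K" "i < \<mu> k" for k i
    unfolding leibniz_transform_eq_iff[where U = U and \<alpha> = \<alpha> and \<mu> = \<mu> and k = k, OF b[OF that(1)] that(2)] U_def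
    by (rule triangular_solve.simps)
  moreover have "degree (U k i) \<le> D" if "k \<in> K" "i < \<mu> k" for k i
    unfolding U_def using deg that by (intro degree_triangular_solve_le) auto
  ultimately show ?thesis by blast
qed

section \<open>The Sylvester matrix\<close>

text \<open>Rows are counted from 0 and their entries run from the highest power down. In the lower
  block, row \<open>degree b + q\<close> gets the exponent \<open>degree a - 1 - q\<close>.\<close>

definition sylvester_row_poly :: "complex poly \<Rightarrow> complex poly \<Rightarrow> nat \<Rightarrow> complex poly" where
  "sylvester_row_poly a b p = (if p < degree b then monom 1 (degree b - 1 - p) * a
     else monom 1 (degree a + degree b - 1 - p) * b)"

lemma sylvester_mat_index_row_poly:
  assumes "p < degree a + degree b" "r < degree a + degree b"
  shows "sylvester_mat a b $$ (p, r) = coeff (sylvester_row_poly a b p) (degree a + degree b - 1 - r)"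
proof (cases "p < degree b")
  case True
  have "degree a + degree b - 1 - r - (degree b - 1 - p) = degree a + p - r" if "r \<le> degree a + p"
    using that True assms by arith
  moreover have "degree b - 1 - p \<le> degree a + degree b - 1 - r \<longleftrightarrow> r \<le> degree a + p"
    using True assms by arith
  \<comment> \<open>Left of the shifted row the index exceeds the degree, so the zeros of the matrix
    agree with vanishing coefficients.\<close>
  moreover have "coeff a (degree a + p - r) = 0" if "\<not> p \<le> r"
    using that by (intro coeff_eq_0) arith
  ultimately show ?thesis
    unfolding sylvester_index_mat[OF assms] sylvester_row_poly_def
    using True by (auto simp: coeff_monom_mult)
next
  case False
  have "degree a + degree b - 1 - r - (degree a + degree b - 1 - p) = p - r" if "r \<le> p"
    using that assms by arith
  moreover have "degree a + degree b - 1 - p \<le> degree a + degree b - 1 - r \<longleftrightarrow> r \<le> p"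
    using assms by arith
  moreover have "coeff b (p - r) = 0" if "\<not> p - degree b \<le> r"
    using that by (intro coeff_eq_0) arith
  ultimately show ?thesis
    unfolding sylvester_index_mat[OF assms] sylvester_row_poly_def
    using False by (auto simp: coeff_monom_mult)
qed

lemma degree_sylvester_row_poly:
  assumes "p < degree a + degree b"
  shows "degree (sylvester_row_poly a b p) \<le> degree a + degree b - 1"
proof -
  have "degree (monom 1 q * f :: complex poly) \<le> q + degree f" for q f
    using degree_mult_le[of "monom 1 q :: complex poly" f] by (simp add: degree_monom_eq)
  from this[of "degree b - 1 - p" a] this[of "degree a + degree b - 1 - p" b]
  show ?thesis using assms unfolding sylvester_row_poly_def by auto
qed

section \<open>Multiplication by \<open>Lambda_deriv\<close> as evaluation of derivatives\<close>

lemma Lambda_deriv_carrier: "Lambda_deriv N i x \<in> carrier_mat N 1"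
  by (intro carrier_matI) (simp_all add: Lambda_deriv_def)

lemma Lambda_deriv_index:
  "r < N \<Longrightarrow> Lambda_deriv N i x $$ (r, 0) = poly ((pderiv ^^ i) (monom 1 (N - 1 - r))) x"
  by (simp add: Lambda_deriv_def mat_of_cols_index)

text \<open>The column holds the derivatives of the monomials, so the product differentiates the
  monomial expansion of \<open>f\<close> term by term.\<close>

lemma coeff_row_mult_Lambda_deriv:
  assumes "degree f \<le> N - 1" "N \<ge> 1"
  shows "(\<Sum>r<N. coeff f (N - 1 - r) * Lambda_deriv N i x $$ (r, 0)) = poly ((pderiv ^^ i) f) x"
proof -
  let ?g = "\<lambda>j. coeff f j * poly ((pderiv ^^ i) (monom 1 j)) x"
  have "(\<Sum>r<N. coeff f (N - 1 - r) * Lambda_deriv N i x $$ (r, 0)) = (\<Sum>r<N. ?g (N - Suc r))"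
    by (intro sum.cong) (auto simp: Lambda_deriv_index)
  also have "\<dots> = (\<Sum>j<N. ?g j)" by (rule sum.nat_diff_reindex)
  also have "\<dots> = (\<Sum>j\<le>N - 1. ?g j)" using assms(2) by (intro sum.cong) auto
  also have "\<dots> = poly ((pderiv ^^ i) (\<Sum>j\<le>N - 1. Polynomial.smult (coeff f j) (monom 1 j))) x"
    by (simp only: higher_pderiv_sum poly_sum higher_pderiv_smult poly_smult)
  also have "(\<Sum>j\<le>N - 1. Polynomial.smult (coeff f j) (monom 1 j)) = f"
    using poly_as_sum_of_monoms'[OF assms(1)] by (simp add: smult_monom)
  finally show ?thesis .
qed

text \<open>Used with \<open>i = 0\<close> to find a kernel vector at a common zero, and for general
  \<open>i\<close> to compute the product \<open>S X\<close>.\<close>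

lemma sylvester_mult_Lambda_deriv:
  assumes "p < degree a + degree b"
  shows "(\<Sum>r<degree a + degree b.
      sylvester_mat a b $$ (p, r) * Lambda_deriv (degree a + degree b) i x $$ (r, 0)) =
    poly ((pderiv ^^ i) (sylvester_row_poly a b p)) x"
  using assms
  by (subst coeff_row_mult_Lambda_deriv[OF degree_sylvester_row_poly[OF assms], symmetric])
    (auto simp: sylvester_mat_index_row_poly)

text \<open>A common zero \<open>x\<close> would put the column of powers of \<open>x\<close> into the kernel.\<close>

lemma sylvester_no_common_zero:
  fixes x :: complex
  assumes det: "Determinant.det (sylvester_mat a b) \<noteq> 0" and "degree a + degree b \<ge> 1"
  shows "\<not> (poly a x = 0 \<and> poly b x = 0)"
proof
  assume ab: "poly a x = 0 \<and> poly b x = 0"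
  let ?N = "degree a + degree b"
  define w where "w = col (Lambda_deriv ?N 0 x) 0"
  have w: "w \<in> carrier_vec ?N"
    unfolding w_def by (metis Lambda_deriv_carrier carrier_matD(1) col_dim)
  have wr: "w $ r = Lambda_deriv ?N 0 x $$ (r, 0)" if "r < ?N" for r
    unfolding w_def using that Lambda_deriv_carrier[of ?N 0 x] by (intro index_col) auto
  \<comment> \<open>The last entry is the power with exponent 0, so \<open>w\<close> is nonzero even
    for \<open>x = 0\<close>.\<close>
  have "w $ (?N - 1) = 1"
    using assms(2) by (subst wr) (auto simp: Lambda_deriv_index)
  then have "w \<noteq> 0\<^sub>v ?N"
    using assms(2) by auto
  moreover have "sylvester_mat a b *\<^sub>v w = 0\<^sub>v ?N"
  proof (rule eq_vecI)
    fix p assume "p < dim_vec (0\<^sub>v ?N :: complex Matrix.vec)"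
    then have p: "p < ?N" by simp
    have "(sylvester_mat a b *\<^sub>v w) $ p =
        (\<Sum>r<?N. sylvester_mat a b $$ (p, r) * Lambda_deriv ?N 0 x $$ (r, 0))"
      using p w wr by (auto simp: scalar_prod_def lessThan_atLeast0 intro!: sum.cong)
    also have "\<dots> = 0"
      unfolding sylvester_mult_Lambda_deriv[OF p] using ab
      by (auto simp: sylvester_row_poly_def)
    finally show "(sylvester_mat a b *\<^sub>v w) $ p = 0\<^sub>v ?N $ p" using p by simp
  qed simp
  ultimately show False
    using det w det_0_iff_vec_prod_zero_field[OF sylvester_carrier_mat[of a b]] by blast
qed

section \<open>Entries of the proposed inverse and of its product with the Sylvester matrix\<close>

lemma mat_mult_row_index:
  assumes "w \<in> carrier_vec N" "r < N" "c < N"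
  shows "(Lambda_deriv N i x * mat_of_row w) $$ (r, c) = Lambda_deriv N i x $$ (r, 0) * w $ c"
  using assms Lambda_deriv_carrier[of N i x] by (auto simp: scalar_prod_def mat_of_row_def)

lemma Lambda_mult_row_carrier:
  "w \<in> carrier_vec N \<Longrightarrow> Lambda_deriv N i x * mat_of_row w \<in> carrier_mat N N"
  by (intro mult_carrier_mat[OF Lambda_deriv_carrier]) auto

lemma row_poly_carrier [simp]: "row_poly k p \<in> carrier_vec k"
  by (simp add: row_poly_def)

lemma Lambda_mult_row_block_carriers [simp]:
  "Lambda_deriv (m + n) i x * mat_of_row (0\<^sub>v n @\<^sub>v row_poly m p) \<in> carrier_mat (m + n) (m + n)"
  "Lambda_deriv (m + n) i x * mat_of_row (row_poly n p @\<^sub>v 0\<^sub>v m) \<in> carrier_mat (m + n) (m + n)"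
  using append_carrier_vec[OF zero_carrier_vec row_poly_carrier, of n m p]
    append_carrier_vec[OF row_poly_carrier zero_carrier_vec, of n p m]
  by (auto intro!: Lambda_mult_row_carrier simp: add.commute)

lemma sylvester_inv_expr_carrier:
  "sylvester_inv_expr m n s \<alpha> \<mu> t \<beta> \<nu> U V \<in> carrier_mat (m + n) (m + n)"
  unfolding sylvester_inv_expr_def
  by (intro add_carrier_mat mat_sum_carrier Lambda_mult_row_block_carriers)

text \<open>The zero padding confines the \<open>V\<close> terms to the first \<open>n\<close>
  columns and the \<open>U\<close> terms to the last \<open>m\<close>.\<close>

lemma sylvester_inv_expr_index:
  assumes r: "r < m + n" and c: "c < m + n"
  shows "sylvester_inv_expr m n s \<alpha> \<mu> t \<beta> \<nu> U V $$ (r, c) =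
    (if c < n then \<Sum>l=1..t. \<Sum>j<\<nu> l. Lambda_deriv (m + n) j (\<beta> l) $$ (r, 0) * coeff (V l j) (n - 1 - c)
     else \<Sum>k=1..s. \<Sum>i<\<mu> k. Lambda_deriv (m + n) i (\<alpha> k) $$ (r, 0) * coeff (U k i) (m - 1 - (c - n)))"
proof -
  have U: "(0\<^sub>v n @\<^sub>v row_poly m p) $ c = (if c < n then 0 else coeff p (m - 1 - (c - n)))"
    and V: "(row_poly n p @\<^sub>v 0\<^sub>v m) $ c = (if c < n then coeff p (n - 1 - c) else 0)" for p
    using c by (auto simp: row_poly_def)
  have carr: "0\<^sub>v n @\<^sub>v row_poly m p \<in> carrier_vec (m + n)" "row_poly n p @\<^sub>v 0\<^sub>v m \<in> carrier_vec (m + n)" for p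
    using append_carrier_vec[OF zero_carrier_vec row_poly_carrier, of n m p]
      append_carrier_vec[OF row_poly_carrier zero_carrier_vec, of n p m]
    by (auto simp: add.commute)
  let ?A = "mat_sum (m + n) (\<lambda>k. mat_sum (m + n) (\<lambda>i.
       Lambda_deriv (m + n) i (\<alpha> k) * mat_of_row (0\<^sub>v n @\<^sub>v row_poly m (U k i))) {..<\<mu> k}) {1..s}"
  let ?B = "mat_sum (m + n) (\<lambda>l. mat_sum (m + n) (\<lambda>j.
       Lambda_deriv (m + n) j (\<beta> l) * mat_of_row (row_poly n (V l j) @\<^sub>v 0\<^sub>v m)) {..<\<nu> l}) {1..t}"
  have "?B \<in> carrier_mat (m + n) (m + n)"
    by (intro mat_sum_carrier Lambda_mult_row_block_carriers)
  then have "sylvester_inv_expr m n s \<alpha> \<mu> t \<beta> \<nu> U V $$ (r, c) = ?A $$ (r, c) + ?B $$ (r, c)"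
    unfolding sylvester_inv_expr_def using r c by (intro index_add_mat(1)) auto
  also have "?A $$ (r, c) = (if c < n then 0 else
      \<Sum>k=1..s. \<Sum>i<\<mu> k. Lambda_deriv (m + n) i (\<alpha> k) $$ (r, 0) * coeff (U k i) (m - 1 - (c - n)))"
    using r c by (simp add: index_mat_sum mat_sum_carrier mat_mult_row_index[OF carr(1)] U
        del: index_mult_mat)
  also have "?B $$ (r, c) = (if c < n then
      \<Sum>l=1..t. \<Sum>j<\<nu> l. Lambda_deriv (m + n) j (\<beta> l) $$ (r, 0) * coeff (V l j) (n - 1 - c) else 0)"
    using r c by (simp add: index_mat_sum mat_sum_carrier mat_mult_row_index[OF carr(2)] V
        del: index_mult_mat)
  finally show ?thesis by simp
qed

text \<open>Once the sum over \<open>r\<close> is moved inside, it evaluates a derivative of the row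
  polynomial at a node; what remains is a coefficient of a Hermite sum.\<close>

lemma sylvester_mult_inv_expr_index:
  fixes a b defines "m \<equiv> degree a" and "n \<equiv> degree b"
  assumes p: "p < m + n" and c: "c < m + n"
  shows "(sylvester_mat a b * sylvester_inv_expr m n s \<alpha> \<mu> t \<beta> \<nu> U V) $$ (p, c) =
    (if c < n then coeff (hermite_sum t \<beta> \<nu> V (sylvester_row_poly a b p)) (n - 1 - c)
     else coeff (hermite_sum s \<alpha> \<mu> U (sylvester_row_poly a b p)) (m - 1 - (c - n)))"
proof -
  \<comment> \<open>Stated for arbitrary nodes and families, so that it serves both column
    blocks.\<close>
  have swap: "(\<Sum>r<m + n. sylvester_mat a b $$ (p, r) *
      (\<Sum>k=1..s. \<Sum>i<\<mu> k. Lambda_deriv (m + n) i (\<alpha> k) $$ (r, 0) * coeff (U k i) d)) =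
    coeff (hermite_sum s \<alpha> \<mu> U (sylvester_row_poly a b p)) d" for s \<alpha> \<mu> U d
  proof -
    have "(\<Sum>r<m + n. sylvester_mat a b $$ (p, r) *
        (\<Sum>k=1..s. \<Sum>i<\<mu> k. Lambda_deriv (m + n) i (\<alpha> k) $$ (r, 0) * coeff (U k i) d)) =
      (\<Sum>k=1..s. \<Sum>r<m + n. \<Sum>i<\<mu> k.
        sylvester_mat a b $$ (p, r) * Lambda_deriv (m + n) i (\<alpha> k) $$ (r, 0) * coeff (U k i) d)"
      unfolding sum_distrib_left mult.assoc by (rule sum.swap)
    also have "\<dots> = (\<Sum>k=1..s. \<Sum>i<\<mu> k. \<Sum>r<m + n.
        sylvester_mat a b $$ (p, r) * Lambda_deriv (m + n) i (\<alpha> k) $$ (r, 0) * coeff (U k i) d)"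
      by (intro sum.cong refl sum.swap)
    also have "\<dots> = coeff (hermite_sum s \<alpha> \<mu> U (sylvester_row_poly a b p)) d"
      unfolding sum_distrib_right[symmetric] coeff_hermite_sum m_def n_def
        sylvester_mult_Lambda_deriv[OF p[unfolded m_def n_def]] ..
    finally show ?thesis .
  qed
  have "(sylvester_mat a b * sylvester_inv_expr m n s \<alpha> \<mu> t \<beta> \<nu> U V) $$ (p, c) =
    (\<Sum>r<m + n. sylvester_mat a b $$ (p, r) * sylvester_inv_expr m n s \<alpha> \<mu> t \<beta> \<nu> U V $$ (r, c))"
    using p c sylvester_carrier_mat[of a b] sylvester_inv_expr_carrier[of m n s \<alpha> \<mu> t \<beta> \<nu> U V]
    unfolding m_def n_def
    by (auto simp: scalar_prod_def lessThan_atLeast0 intro!: sum.cong)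
  also have "\<dots> = (\<Sum>r<m + n. sylvester_mat a b $$ (p, r) *
    (if c < n then \<Sum>l=1..t. \<Sum>j<\<nu> l. Lambda_deriv (m + n) j (\<beta> l) $$ (r, 0) * coeff (V l j) (n - 1 - c)
     else \<Sum>k=1..s. \<Sum>i<\<mu> k. Lambda_deriv (m + n) i (\<alpha> k) $$ (r, 0) * coeff (U k i) (m - 1 - (c - n))))"
    using c by (intro sum.cong refl) (simp add: sylvester_inv_expr_index)
  also have "\<dots> = (if c < n then coeff (hermite_sum t \<beta> \<nu> V (sylvester_row_poly a b p)) (n - 1 - c)
     else coeff (hermite_sum s \<alpha> \<mu> U (sylvester_row_poly a b p)) (m - 1 - (c - n)))"
    using swap by simp
  finally show ?thesis .
qed

section \<open>The inverse identity as a condition on Hermite sums\<close>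

lemma poly_eq_iff_reversed_coeffs:
  assumes "degree p \<le> d - 1" "degree q \<le> d - 1" "d \<ge> 1"
  shows "p = q \<longleftrightarrow> (\<forall>c<d. coeff p (d - 1 - c) = coeff q (d - 1 - c))"
proof
  assume *: "\<forall>c<d. coeff p (d - 1 - c) = coeff q (d - 1 - c)"
  show "p = q"
  proof (rule poly_eqI)
    fix i show "coeff p i = coeff q i"
    proof (cases "i < d")
      case True
      then show ?thesis using *[rule_format, of "d - 1 - i"] by simp
    next
      \<comment> \<open>Here \<open>d \<ge> 1\<close> matters: for \<open>d = 0\<close> the
        truncated bound \<open>d - 1\<close> would still admit nonzero constants.\<close>
      case False
      then show ?thesis using assms by (simp add: coeff_eq_0)
    qed
  qed
qed simp

text \<open>Row polynomials are multiples of \<open>a\<close> in the upper block and of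
  \<open>b\<close> in the lower one. So two blocks of \<open>S X\<close> vanish, and the other two
  compare Hermite sums with monomials.\<close>

lemma sylvester_inv_rep_iff:
  fixes a b defines "m \<equiv> degree a" and "n \<equiv> degree b"
  assumes mn: "m \<ge> 1" "n \<ge> 1"
    and a: "\<And>k. k \<in> {1..s} \<Longrightarrow> [:- \<alpha> k, 1:] ^ \<mu> k dvd a"
    and b: "\<And>l. l \<in> {1..t} \<Longrightarrow> [:- \<beta> l, 1:] ^ \<nu> l dvd b"
  shows "sylvester_inv_rep a b m n s \<alpha> \<mu> t \<beta> \<nu> U V \<longleftrightarrow>
     (\<forall>k\<in>{1..s}. \<forall>i<\<mu> k. degree (U k i) \<le> m - 1) \<and>
     (\<forall>l\<in>{1..t}. \<forall>j<\<nu> l. degree (V l j) \<le> n - 1) \<and>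
     (\<forall>q<m. hermite_sum s \<alpha> \<mu> U (monom 1 q * b) = monom 1 q) \<and>
     (\<forall>q<n. hermite_sum t \<beta> \<nu> V (monom 1 q * a) = monom 1 q)"
proof -
  let ?S = "sylvester_mat a b" and ?X = "sylvester_inv_expr m n s \<alpha> \<mu> t \<beta> \<nu> U V"
  let ?f = "sylvester_row_poly a b"
  have S: "?S \<in> carrier_mat (m + n) (m + n)" unfolding m_def n_def by (rule sylvester_carrier_mat)
  note X = sylvester_inv_expr_carrier[of m n s \<alpha> \<mu> t \<beta> \<nu> U V]
  \<comment> \<open>For square matrices a right inverse is two-sided, so one product
    suffices.\<close>
  have inv: "inverts_mat ?S ?X \<and> inverts_mat ?X ?S \<longleftrightarrow> ?S * ?X = 1\<^sub>m (m + n)"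
    using mat_mult_left_right_inverse[OF S X] S X unfolding inverts_mat_def by auto
  have "(?S * ?X = 1\<^sub>m (m + n)) \<longleftrightarrow>
     (\<forall>q<m. hermite_sum s \<alpha> \<mu> U (monom 1 q * b) = monom 1 q) \<and>
     (\<forall>q<n. hermite_sum t \<beta> \<nu> V (monom 1 q * a) = monom 1 q)"
    if degU: "\<forall>k\<in>{1..s}. \<forall>i<\<mu> k. degree (U k i) \<le> m - 1"
      and degV: "\<forall>l\<in>{1..t}. \<forall>j<\<nu> l. degree (V l j) \<le> n - 1"
  proof -
    have dU: "degree (hermite_sum s \<alpha> \<mu> U f) \<le> m - 1" for f
      using degU by (intro degree_hermite_sum_le) auto
    have dV: "degree (hermite_sum t \<beta> \<nu> V f) \<le> n - 1" for f
      using degV by (intro degree_hermite_sum_le) auto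
    have U0: "hermite_sum s \<alpha> \<mu> U (monom 1 q * a) = 0" for q
      using a by (intro hermite_sum_eq_0) auto
    have V0: "hermite_sum t \<beta> \<nu> V (monom 1 q * b) = 0" for q
      using b by (intro hermite_sum_eq_0) auto
    have f1: "?f p = monom 1 (n - 1 - p) * a" if "p < n" for p
      using that by (simp add: sylvester_row_poly_def n_def)
    have f2: "?f (n + q) = monom 1 (m - 1 - q) * b" for q
      by (simp add: sylvester_row_poly_def n_def m_def)
    have SX: "(?S * ?X) $$ (p, c) = (if c < n then coeff (hermite_sum t \<beta> \<nu> V (?f p)) (n - 1 - c)
        else coeff (hermite_sum s \<alpha> \<mu> U (?f p)) (m - 1 - (c - n)))" if "p < m + n" "c < m + n" for p c
      using that unfolding m_def n_def by (rule sylvester_mult_inv_expr_index)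
    show ?thesis
    proof
      assume eq: "?S * ?X = 1\<^sub>m (m + n)"
      show "(\<forall>q<m. hermite_sum s \<alpha> \<mu> U (monom 1 q * b) = monom 1 q) \<and>
        (\<forall>q<n. hermite_sum t \<beta> \<nu> V (monom 1 q * a) = monom 1 q)"
      proof (intro conjI allI impI)
        fix q assume q: "q < m"
        have "coeff (hermite_sum s \<alpha> \<mu> U (monom 1 q * b)) (m - 1 - c) = coeff (monom 1 q) (m - 1 - c)"
          if "c < m" for c
        proof -
          \<comment> \<open>Exponents decrease down the block, so the polynomial
            \<open>monom 1 q * b\<close> sits in row \<open>n + (m - 1 - q)\<close>.\<close>
          have "n + (m - 1 - q) < m + n" "n + c < m + n" "m - 1 - (m - 1 - q) = q"
            "n + (m - 1 - q) = n + c \<longleftrightarrow> q = m - 1 - c"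
            using q that by arith+
          with SX[of "n + (m - 1 - q)" "n + c"] show ?thesis unfolding f2 eq by simp
        qed
        then show "hermite_sum s \<alpha> \<mu> U (monom 1 q * b) = monom 1 q"
          using q mn by (subst poly_eq_iff_reversed_coeffs[OF dU]) (auto simp: degree_monom_eq)
      next
        fix q assume q: "q < n"
        have "coeff (hermite_sum t \<beta> \<nu> V (monom 1 q * a)) (n - 1 - c) = coeff (monom 1 q) (n - 1 - c)"
          if "c < n" for c
        proof -
          have "n - 1 - q < n" "n - 1 - q < m + n" "c < m + n" "n - 1 - (n - 1 - q) = q"
            "n - 1 - q = c \<longleftrightarrow> q = n - 1 - c"
            using q that by arith+
          with SX[of "n - 1 - q" c] f1[of "n - 1 - q"] that show ?thesis unfolding eq by simp
        qed
        then show "hermite_sum t \<beta> \<nu> V (monom 1 q * a) = monom 1 q"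
          using q mn by (subst poly_eq_iff_reversed_coeffs[OF dV]) (auto simp: degree_monom_eq)
      qed
    next
      assume H: "(\<forall>q<m. hermite_sum s \<alpha> \<mu> U (monom 1 q * b) = monom 1 q) \<and>
        (\<forall>q<n. hermite_sum t \<beta> \<nu> V (monom 1 q * a) = monom 1 q)"
      show "?S * ?X = 1\<^sub>m (m + n)"
      proof (rule eq_matI)
        fix p c assume "p < dim_row (1\<^sub>m (m + n) :: complex mat)" "c < dim_col (1\<^sub>m (m + n) :: complex mat)"
        then have pc: "p < m + n" "c < m + n" by auto
        show "(?S * ?X) $$ (p, c) = 1\<^sub>m (m + n) $$ (p, c)"
        proof (cases "p < n")
          case True
          then show ?thesis using SX[OF pc] pc H f1[OF True] U0 by auto
        next
          case False
          then obtain q where q: "p = n + q" by (metis le_Suc_ex not_less)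
          with pc have "q < m" "m - 1 - q < m" by arith+
          with H have "hermite_sum s \<alpha> \<mu> U (monom 1 (m - 1 - q) * b) = monom 1 (m - 1 - q)" by blast
          \<comment> \<open>The coefficient of the monomial is 1 exactly on the diagonal; the bounds
            on \<open>q\<close> and \<open>c\<close> guard against truncated subtraction.\<close>
          moreover have "m - 1 - q = m - 1 - (c - n) \<longleftrightarrow> n + q = c" if "\<not> c < n"
            using that pc q by arith
          ultimately show ?thesis using SX[OF pc] pc V0 unfolding q f2 by simp
        qed
      qed (use S X in auto)
    qed
  qed
  then show ?thesis unfolding sylvester_inv_rep_def inv by blast
qed

section \<open>Existence, uniqueness and recurrence for the inverse Sylvester matrix\<close>

theorem theorem2:
  fixes a b :: "complex poly" and a0 b0 :: complex
    and s t m n :: nat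
    and \<alpha> \<beta> :: "nat \<Rightarrow> complex" and \<mu> \<nu> :: "nat \<Rightarrow> nat"
    and u v :: "nat \<Rightarrow> nat \<Rightarrow> complex poly"
  assumes a: "a = Polynomial.smult a0 (\<Prod>k=1..s. [:- \<alpha> k, 1:] ^ \<mu> k)"
    and b: "b = Polynomial.smult b0 (\<Prod>l=1..t. [:- \<beta> l, 1:] ^ \<nu> l)"
    and m: "m = (\<Sum>k=1..s. \<mu> k)" "m \<ge> 1"
    and n: "n = (\<Sum>l=1..t. \<nu> l)" "n \<ge> 1"
    and a0b0: "a0 * b0 \<noteq> 0"
    and \<mu>_pos: "\<And>k. k \<in> {1..s} \<Longrightarrow> \<mu> k > 0"
    and \<nu>_pos: "\<And>l. l \<in> {1..t} \<Longrightarrow> \<nu> l > 0"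
    and \<alpha>_inj: "inj_on \<alpha> {1..s}"
    and \<beta>_inj: "inj_on \<beta> {1..t}"
    and u: "fundamental_polys s \<alpha> \<mu> u"
    and v: "fundamental_polys t \<beta> \<nu> v"
    and det: "Determinant.det (sylvester_mat a b) \<noteq> 0"
  shows
    "(\<exists>U V. sylvester_inv_rep a b m n s \<alpha> \<mu> t \<beta> \<nu> U V) \<and>
     (\<forall>U V U' V'.
        sylvester_inv_rep a b m n s \<alpha> \<mu> t \<beta> \<nu> U V \<and> sylvester_inv_rep a b m n s \<alpha> \<mu> t \<beta> \<nu> U' V' \<longrightarrow>
        (\<forall>k\<in>{1..s}. \<forall>i<\<mu> k. U k i = U' k i) \<and> (\<forall>l\<in>{1..t}. \<forall>j<\<nu> l. V l j = V' l j)) \<and>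
     (\<forall>U V. sylvester_inv_rep a b m n s \<alpha> \<mu> t \<beta> \<nu> U V \<longrightarrow>
        (\<forall>k\<in>{1..s}. poly b (\<alpha> k) \<noteq> 0 \<and>
           (\<forall>i<\<mu> k. U k i = Polynomial.smult (1 / poly b (\<alpha> k))
              (u k i - (\<Sum>i1=i+1..<\<mu> k. Polynomial.smult
                 (of_nat (i1 choose i) * poly ((pderiv ^^ (i1 - i)) b) (\<alpha> k)) (U k i1))))) \<and>
        (\<forall>l\<in>{1..t}. poly a (\<beta> l) \<noteq> 0 \<and>
           (\<forall>j<\<nu> l. V l j = Polynomial.smult (1 / poly a (\<beta> l))
              (v l j - (\<Sum>j1=j+1..<\<nu> l. Polynomial.smult
                 (of_nat (j1 choose j) * poly ((pderiv ^^ (j1 - j)) a) (\<beta> l)) (V l j1))))))"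
proof -
  have a0: "a0 \<noteq> 0" and b0: "b0 \<noteq> 0" using a0b0 by auto
  have da: "degree a = m" unfolding a m(1) using a0 by (simp add: degree_prod_linear_power)
  have db: "degree b = n" unfolding b n(1) using b0 by (simp add: degree_prod_linear_power)
  have adv: "[:- \<alpha> k, 1:] ^ \<mu> k dvd a" if "k \<in> {1..s}" for k
    unfolding a using that by (intro dvd_smult dvd_prodI) auto
  have bdv: "[:- \<beta> l, 1:] ^ \<nu> l dvd b" if "l \<in> {1..t}" for l
    unfolding b using that by (intro dvd_smult dvd_prodI) auto
  \<comment> \<open>This is where \<open>det\<close> enters. As \<open>\<alpha> k\<close> is a zero
    of \<open>a\<close>, it is not one of \<open>b\<close>, and the diagonal entries
    \<open>b(\<alpha> k)\<close> are invertible; likewise \<open>a(\<beta> l)\<close>.\<close>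
  have no_common: "\<not> (poly a x = 0 \<and> poly b x = 0)" for x
    using sylvester_no_common_zero[OF det] m(2) da by simp
  have b\<alpha>: "poly b (\<alpha> k) \<noteq> 0" if "k \<in> {1..s}" for k
    using no_common[of "\<alpha> k"] higher_pderiv_linear_power_zero[OF adv[OF that] \<mu>_pos[OF that]] by simp
  have a\<beta>: "poly a (\<beta> l) \<noteq> 0" if "l \<in> {1..t}" for l
    using no_common[of "\<beta> l"] higher_pderiv_linear_power_zero[OF bdv[OF that] \<nu>_pos[OF that]] by simp
  \<comment> \<open>The matrix identity is now a pair of independent triangular systems. Solving
    them gives existence, their injectivity gives uniqueness, and rearranging them gives the
    recurrences.\<close>
  have rep: "sylvester_inv_rep a b m n s \<alpha> \<mu> t \<beta> \<nu> U V \<longleftrightarrow>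
     (\<forall>k\<in>{1..s}. \<forall>i<\<mu> k. degree (U k i) \<le> m - 1) \<and>
     (\<forall>l\<in>{1..t}. \<forall>j<\<nu> l. degree (V l j) \<le> n - 1) \<and>
     (\<forall>k\<in>{1..s}. \<forall>i<\<mu> k. leibniz_transform \<alpha> \<mu> b U k i = u k i) \<and>
     (\<forall>l\<in>{1..t}. \<forall>j<\<nu> l. leibniz_transform \<beta> \<nu> a V l j = v l j)" for U V
    using sylvester_inv_rep_iff[of a b s \<alpha> \<mu> t \<beta> \<nu> U V] adv bdv m n da db
      hermite_sum_mult_eq_iff[OF \<alpha>_inj _ u, of U b] hermite_sum_mult_eq_iff[OF \<beta>_inj _ v, of V a]
    by simp
  have ex: "\<exists>U V. sylvester_inv_rep a b m n s \<alpha> \<mu> t \<beta> \<nu> U V"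
  proof -
    obtain U where "\<forall>k\<in>{1..s}. \<forall>i<\<mu> k. degree (U k i) \<le> m - 1 \<and> leibniz_transform \<alpha> \<mu> b U k i = u k i"
      using leibniz_transform_surj[of "{1..s}" b \<alpha> \<mu> u "m - 1"] b\<alpha> u
      unfolding fundamental_polys_def m(1) by blast
    moreover obtain V where
      "\<forall>l\<in>{1..t}. \<forall>j<\<nu> l. degree (V l j) \<le> n - 1 \<and> leibniz_transform \<beta> \<nu> a V l j = v l j"
      using leibniz_transform_surj[of "{1..t}" a \<beta> \<nu> v "n - 1"] a\<beta> v
      unfolding fundamental_polys_def n(1) by blast
    ultimately show ?thesis unfolding rep by blast
  qed
  have unique_U: "U k i = U' k i"
    if "sylvester_inv_rep a b m n s \<alpha> \<mu> t \<beta> \<nu> U V" "sylvester_inv_rep a b m n s \<alpha> \<mu> t \<beta> \<nu> U' V'"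
      and k: "k \<in> {1..s}" "i < \<mu> k" for U V U' V' k i
  proof (rule leibniz_transform_inj[where \<alpha> = \<alpha> and \<mu> = \<mu>, OF b\<alpha>[OF k(1)] _ k(2)])
    show "leibniz_transform \<alpha> \<mu> b U k i = leibniz_transform \<alpha> \<mu> b U' k i" if "i < \<mu> k" for i
      using \<open>sylvester_inv_rep a b m n s \<alpha> \<mu> t \<beta> \<nu> U V\<close>
        \<open>sylvester_inv_rep a b m n s \<alpha> \<mu> t \<beta> \<nu> U' V'\<close> k(1) that unfolding rep by simp
  qed
  have unique_V: "V l j = V' l j"
    if "sylvester_inv_rep a b m n s \<alpha> \<mu> t \<beta> \<nu> U V" "sylvester_inv_rep a b m n s \<alpha> \<mu> t \<beta> \<nu> U' V'"
      and l: "l \<in> {1..t}" "j < \<nu> l" for U V U' V' l j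
  proof (rule leibniz_transform_inj[where \<alpha> = \<beta> and \<mu> = \<nu>, OF a\<beta>[OF l(1)] _ l(2)])
    show "leibniz_transform \<beta> \<nu> a V l j = leibniz_transform \<beta> \<nu> a V' l j" if "j < \<nu> l" for j
      using \<open>sylvester_inv_rep a b m n s \<alpha> \<mu> t \<beta> \<nu> U V\<close>
        \<open>sylvester_inv_rep a b m n s \<alpha> \<mu> t \<beta> \<nu> U' V'\<close> l(1) that unfolding rep by simp
  qed
  have rec_U: "U k i = Polynomial.smult (1 / poly b (\<alpha> k))
      (u k i - (\<Sum>i1=i+1..<\<mu> k. Polynomial.smult
         (of_nat (i1 choose i) * poly ((pderiv ^^ (i1 - i)) b) (\<alpha> k)) (U k i1)))"
    if "sylvester_inv_rep a b m n s \<alpha> \<mu> t \<beta> \<nu> U V" "k \<in> {1..s}" "i < \<mu> k" for U V k i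
    by (rule iffD1[OF leibniz_transform_eq_iff[where U = U and \<alpha> = \<alpha> and \<mu> = \<mu> and k = k, OF b\<alpha>[OF that(2)] that(3)]])
      (use that in \<open>simp add: rep\<close>)
  have rec_V: "V l j = Polynomial.smult (1 / poly a (\<beta> l))
      (v l j - (\<Sum>j1=j+1..<\<nu> l. Polynomial.smult
         (of_nat (j1 choose j) * poly ((pderiv ^^ (j1 - j)) a) (\<beta> l)) (V l j1)))"
    if "sylvester_inv_rep a b m n s \<alpha> \<mu> t \<beta> \<nu> U V" "l \<in> {1..t}" "j < \<nu> l" for U V l j
    by (rule iffD1[OF leibniz_transform_eq_iff[where U = V and \<alpha> = \<beta> and \<mu> = \<nu> and k = l, OF a\<beta>[OF that(2)] that(3)]])
      (use that in \<open>simp add: rep\<close>)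
  show ?thesis
  proof (intro conjI allI impI ballI, goal_cases)
    case 1
    show ?case by (rule ex)
  next
    case (2 U V U' V' k i)
    show ?case by (rule unique_U[of U V U' V' k i]) (use 2 in blast)+
  next
    case (3 U V U' V' l j)
    show ?case by (rule unique_V[of U V U' V' l j]) (use 3 in blast)+
  next
    case (4 U V k)
    show ?case by (rule b\<alpha>[OF 4(2)])
  next
    case (5 U V k i)
    show ?case by (rule rec_U[OF 5])
  next
    case (6 U V l)
    show ?case by (rule a\<beta>[OF 6(2)])
  next
    case (7 U V l j)
    show ?case by (rule rec_V[OF 7])
  qed
qed

end
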